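(* Let $U\subset\Lambda$ be a neighbourhood of the set $\mathrm{Tr}$ of trajectories of $f$ in the Tychonoff topology. Then there exists $d_0>0$ such that, for any symbolic image $G$ constructed for a covering $C$ of $M$ with diameter $d\leqslant d_0$, any trace $\chi(\omega)$ of any admissible path $\omega$ on $G$ lies in $U$.
   Context: $M$ is a compact Riemannian manifold with distance $\rho$, and $f\colon M\to M$ is a homeomorphism. $\Lambda$ is the set of all doubly infinite sequences $\zeta=\{x_k,\ k\in\mathbb{Z}\}$ of points of $M$, with the topology (called the Tychonoff topology) given by the distance $r(\{x_k\},\{y_k\})=\sum_{k=-\infty}^{\infty}\rho(x_k,y_k)/2^{|k|}$. $\mathrm{Tr}\subset\Lambda$ is the set of trajectories, i.e. sequences with $x_{k+1}=f(x_k)$ for all $k\in\mathbb{Z}$. A covering $C$ is a finite covering of $M$ by closed (nonempty) sets $M(i)$ called cells; cells are taken to be polyhedral (as in a triangulation of $M$), distinct cells intersecting in boundary discs. The diameter of $C$ is the greatest of the diameters of its cells. The symbolic image of $f$ for $C=\{M(1),\dots,M(n)\}$ is the directed graph $G$ with vertices $i=1,\dots,n$ and an arc $i\to j$ if and only if $f(M(i))\cap M(j)\neq\varnothing$. An admissible path on $G$ is a doubly infinite sequence $\omega=\{i_k\}_{k\in\mathbb{Z}}$ of vertices such that $i_k\to i_{k+1}$ is an arc for each $k$. A trace $\chi(\omega)$ of the path $\omega$ is any sequence of points $\{x_k\}_{k\in\mathbb{Z}}$ with $x_k\in M(i_k)$ for all $k$ (a trace is not uniquely determined by $\omega$). *)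

theory Defs
  imports "HOL-Analysis.Analysis" "Graph_Theory.Digraph"
begin

section \<open>Smooth maps between normed spaces\<close>

text \<open>
  On open subsets of a finite-dimensional space these are the usual classes \<open>C\<^sup>k\<close>, \<open>C\<^sup>\<infinity>\<close>.
\<close>

primrec Ck_on :: "nat \<Rightarrow> ('a::real_normed_vector \<Rightarrow> 'b::real_normed_vector) \<Rightarrow> 'a set \<Rightarrow> bool" where
  "Ck_on 0 = (\<lambda>f S. continuous_on S f)"
| "Ck_on (Suc k) = (\<lambda>f S. (\<forall>x\<in>S. f differentiable (at x)) \<and>
     (\<forall>v. Ck_on k (\<lambda>x. frechet_derivative f (at x) v) S))"

definition smooth_on :: "'a set \<Rightarrow> ('a::real_normed_vector \<Rightarrow> 'b::real_normed_vector) \<Rightarrow> bool" where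
  "smooth_on S f \<longleftrightarrow> (\<forall>k. Ck_on k f S)"


section \<open>Compact Riemannian manifolds\<close>

text \<open>
  The manifold is a whole type \<open>'a\<close> of class \<^class>\<open>metric_space\<close>; its distance is \<^const>\<open>dist\<close>.
  It is modelled on a finite-dimensional normed space \<open>'e\<close>. The class \<open>euclidean_space\<close>
  is not used for \<open>'e\<close> because it excludes dimension 0.
  A chart is a pair of a coordinate domain and a coordinate map.
\<close>

type_synonym ('a, 'e) chart = "'a set \<times> ('a \<Rightarrow> 'e)"

definition transition :: "('a, 'e) chart \<Rightarrow> ('a, 'e) chart \<Rightarrow> 'e \<Rightarrow> 'e" where
  "transition c c' = snd c' \<circ> inv_into (fst c) (snd c)"

definition smooth_atlas ::
    "('a::metric_space, 'e::real_normed_vector) chart set \<Rightarrow> bool" where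
  "smooth_atlas A \<longleftrightarrow>
     (\<exists>B :: 'e set. finite B \<and> span B = UNIV) \<and>
     (\<Union>(fst ` A) = UNIV) \<and>
     (\<forall>(U, \<phi>)\<in>A. open U \<and> open (\<phi> ` U) \<and> (\<exists>\<psi>. homeomorphism U (\<phi> ` U) \<phi> \<psi>)) \<and>
     (\<forall>(U, \<phi>)\<in>A. \<forall>(V, \<psi>)\<in>A. smooth_on (\<phi> ` (U \<inter> V)) (transition (U, \<phi>) (V, \<psi>)))"

text \<open>
  \<open>g c p v w\<close> is the inner product of the two tangent vectors at \<open>p\<close> whose
  components in the chart \<open>c\<close> are \<open>v\<close> and \<open>w\<close>.
\<close>

type_synonym ('a, 'e) metric_tensor = "('a, 'e) chart \<Rightarrow> 'a \<Rightarrow> 'e \<Rightarrow> 'e \<Rightarrow> real"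

definition riemannian_metric ::
    "('a::metric_space, 'e::real_normed_vector) chart set \<Rightarrow> ('a, 'e) metric_tensor \<Rightarrow> bool" where
  "riemannian_metric A g \<longleftrightarrow>
     (\<forall>c\<in>A. \<forall>p\<in>fst c. bilinear (g c p) \<and> (\<forall>v w. g c p v w = g c p w v) \<and>
        (\<forall>v. v \<noteq> 0 \<longrightarrow> g c p v v > 0)) \<and>
     (\<forall>(U, \<phi>)\<in>A. \<forall>v w. smooth_on (\<phi> ` U) (\<lambda>x. g (U, \<phi>) (inv_into U \<phi> x) v w)) \<and>
     (\<forall>c\<in>A. \<forall>c'\<in>A. \<forall>p\<in>fst c \<inter> fst c'. \<forall>v w.
        let D = frechet_derivative (transition c c') (at (snd c p))
        in g c p v w = g c' p (D v) (D w))"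

definition piecewise_C1_curve ::
    "('a::metric_space, 'e::real_normed_vector) chart set \<Rightarrow> real set \<Rightarrow> (real \<Rightarrow> 'a) \<Rightarrow> bool" where
  "piecewise_C1_curve A S \<gamma> \<longleftrightarrow> continuous_on {0..1} \<gamma> \<and> finite S \<and>
     (\<forall>(U, \<phi>)\<in>A. (\<phi> \<circ> \<gamma>) C1_differentiable_on {t \<in> {0<..<1} - S. \<gamma> t \<in> U})"

text \<open>
  The length is a relation, with \<open>s\<close> the speed of the curve: where the integral of the speed
  diverges, \<^const>\<open>integral\<close> would give the value 0, whereas here such a curve has no length.
\<close>

definition has_length ::
    "('a::metric_space, 'e::real_normed_vector) chart set \<Rightarrow> ('a, 'e) metric_tensor
      \<Rightarrow> (real \<Rightarrow> 'a) \<Rightarrow> real \<Rightarrow> bool" where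
  "has_length A g \<gamma> L \<longleftrightarrow>
     (\<exists>S s. piecewise_C1_curve A S \<gamma> \<and>
        (\<forall>(U, \<phi>)\<in>A. \<forall>t\<in>{0<..<1} - S. \<gamma> t \<in> U \<longrightarrow>
           (let v = vector_derivative (\<phi> \<circ> \<gamma>) (at t) in s t = sqrt (g (U, \<phi>) (\<gamma> t) v v))) \<and>
        (s has_integral L) {0..1})"

definition lengths ::
    "('a::metric_space, 'e::real_normed_vector) chart set \<Rightarrow> ('a, 'e) metric_tensor
      \<Rightarrow> 'a \<Rightarrow> 'a \<Rightarrow> real set" where
  "lengths A g p q = {L. \<exists>\<gamma>. \<gamma> 0 = p \<and> \<gamma> 1 = q \<and> has_length A g \<gamma> L}"

text \<open>
  The distance is the infimum of the lengths of curves. Connectedness is not required: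
  between different components there are no curves, and \<^const>\<open>dist\<close> is there only
  subject to the metric axioms. The charts are homeomorphisms for the topology of
  \<^const>\<open>dist\<close>, which is therefore the manifold topology.
\<close>

definition compact_riemannian_manifold ::
    "('a::metric_space, 'e::real_normed_vector) chart set \<Rightarrow> ('a, 'e) metric_tensor \<Rightarrow> bool" where
  "compact_riemannian_manifold A g \<longleftrightarrow>
     compact (UNIV :: 'a set) \<and> smooth_atlas A \<and> riemannian_metric A g \<and>
     (\<forall>p q. lengths A g p q \<noteq> {} \<longrightarrow> dist p q = Inf (lengths A g p q))"


section \<open>Sequences and trajectories\<close>

definition seq_dist :: "(int \<Rightarrow> 'a::metric_space) \<Rightarrow> (int \<Rightarrow> 'a) \<Rightarrow> real" where
  "seq_dist x y = (\<Sum>\<^sub>\<infinity>k\<in>UNIV. dist (x k) (y k) / 2 ^ nat \<bar>k\<bar>)"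

text \<open>
  On a compact \<open>'a\<close> the series converges and \<^const>\<open>seq_dist\<close> is a metric.
\<close>

definition tychonoff_topology :: "(int \<Rightarrow> 'a::metric_space) topology" where
  "tychonoff_topology = Metric_space.mtopology UNIV seq_dist"

definition set_neighbourhood :: "'b topology \<Rightarrow> 'b set \<Rightarrow> 'b set \<Rightarrow> bool" where
  "set_neighbourhood X T U \<longleftrightarrow> U \<subseteq> topspace X \<and> (\<exists>V. openin X V \<and> T \<subseteq> V \<and> V \<subseteq> U)"

definition trajectories :: "('a \<Rightarrow> 'a) \<Rightarrow> (int \<Rightarrow> 'a) set" where
  "trajectories f = {x. \<forall>k. x (k + 1) = f (x k)}"


section \<open>Coverings and symbolic images\<close>

text \<open>
  A curvilinear polyhedral disc: a topological copy of a nonempty convex polytope in the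
  model space \<open>'e\<close>.
\<close>

definition polyhedral_disc :: "'e::real_normed_vector itself \<Rightarrow> 'a::metric_space set \<Rightarrow> bool" where
  "polyhedral_disc _ D \<longleftrightarrow> (\<exists>P :: 'e set. polytope P \<and> P \<noteq> {} \<and> D homeomorphic P)"

text \<open>
  The cells are \<open>M 1, \<dots>, M n\<close>. Two distinct cells may meet in several boundary discs
  (as do two arcs covering a circle), or in none.
\<close>

definition cell_covering ::
    "'e::real_normed_vector itself \<Rightarrow> nat \<Rightarrow> (nat \<Rightarrow> 'a::metric_space set) \<Rightarrow> bool" where
  "cell_covering E n M \<longleftrightarrow>
     (\<Union>i\<in>{1..n}. M i) = UNIV \<and>
     (\<forall>i\<in>{1..n}. closed (M i) \<and> M i \<noteq> {} \<and> polyhedral_disc E (M i)) \<and>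
     (\<forall>i\<in>{1..n}. \<forall>j\<in>{1..n}. M i \<noteq> M j \<longrightarrow>
        (\<exists>\<D>. finite \<D> \<and> M i \<inter> M j = \<Union>\<D> \<and>
           (\<forall>D\<in>\<D>. polyhedral_disc E D \<and> D \<subseteq> frontier (M i) \<inter> frontier (M j))))"

definition covering_diameter :: "nat \<Rightarrow> (nat \<Rightarrow> 'a::metric_space set) \<Rightarrow> real" where
  "covering_diameter n M = Max ((\<lambda>i. diameter (M i)) ` {1..n})"

definition symbolic_image ::
    "('a \<Rightarrow> 'a) \<Rightarrow> nat \<Rightarrow> (nat \<Rightarrow> 'a set) \<Rightarrow> (nat, nat \<times> nat) pre_digraph" where
  "symbolic_image f n M =
     \<lparr>verts = {1..n},
      arcs = {(i, j). i \<in> {1..n} \<and> j \<in> {1..n} \<and> f ` M i \<inter> M j \<noteq> {}},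
      tail = fst, head = snd\<rparr>"

definition admissible_path :: "('v, 'e) pre_digraph \<Rightarrow> (int \<Rightarrow> 'v) \<Rightarrow> bool" where
  "admissible_path G \<omega> \<longleftrightarrow> (\<forall>k. \<omega> k \<in> verts G \<and> \<omega> k \<rightarrow>\<^bsub>G\<^esub> \<omega> (k + 1))"

definition is_trace :: "(nat \<Rightarrow> 'a set) \<Rightarrow> (int \<Rightarrow> nat) \<Rightarrow> (int \<Rightarrow> 'a) \<Rightarrow> bool" where
  "is_trace M \<omega> x \<longleftrightarrow> (\<forall>k. x k \<in> M (\<omega> k))"

end

theory Submission
  imports Defs
begin

text \<open>
  The defect \<open>seq_dist (f \<circ> x) (x \<circ> shift)\<close> of a sequence \<open>x\<close> is a continuous function on the
  compact space of all sequences, and it vanishes exactly on the trajectories. On the complement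
  of an open neighbourhood of the trajectories it therefore has a positive lower bound. A trace is
  a pseudo-orbit: \<open>f (x k)\<close> is close to \<open>x (k + 1)\<close> uniformly in \<open>k\<close>, because both are close to
  an image point in the cell \<open>M (\<omega> (k + 1))\<close>. So for coverings of small diameter its
  defect is below that bound.
\<close>

lemma summable_on_inverse_power_abs_int:
  "(\<lambda>k::int. 1 / 2 ^ nat \<bar>k\<bar> :: real) summable_on UNIV"
proof -
  let ?w = "\<lambda>k::int. 1 / 2 ^ nat \<bar>k\<bar> :: real"
  have geo: "(\<lambda>n::nat. 1 / 2 ^ n :: real) summable_on UNIV"
    using summable_geometric[of "1/2 :: real"]
    by (subst summable_on_UNIV_nonneg_real_iff) (simp_all add: power_divide)
  have "?w summable_on range int"
    by (subst summable_on_reindex) (auto simp: o_def geo)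
  moreover have "?w summable_on range (\<lambda>n. - int n)"
    by (subst summable_on_reindex) (auto simp: o_def geo inj_on_def)
  \<comment> \<open>The two rays overlap in 0, which is harmless since unions preserve summability
    without disjointness.\<close>
  ultimately have "?w summable_on (range int \<union> range (\<lambda>n. - int n))"
    by (rule summable_on_union)
  moreover have "range int \<union> range (\<lambda>n. - int n) = UNIV"
    by (auto simp: image_iff) (metis int_cases2)
  ultimately show ?thesis by simp
qed

definition weight_sum :: real where
  "weight_sum = (\<Sum>\<^sub>\<infinity>k::int. 1 / 2 ^ nat \<bar>k\<bar>)"

lemma weight_sum_nonneg: "weight_sum \<ge> 0"
  unfolding weight_sum_def by (intro infsum_nonneg) auto

text \<open>Needed before any estimate: \<open>infsum\<close> is 0 on a family that is not summable,
  so \<open>seq_dist\<close> means the series only under a uniform bound such as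
  \<open>D\<close>.\<close>

lemma summable_on_seq_dist:
  assumes "\<And>k. dist (x k) (y k) \<le> D"
  shows "(\<lambda>k::int. dist (x k) (y k) / 2 ^ nat \<bar>k\<bar>) summable_on UNIV"
proof (rule summable_on_comparison_test)
  show "(\<lambda>k::int. D * (1 / 2 ^ nat \<bar>k\<bar>)) summable_on UNIV"
    by (intro summable_on_cmult_right summable_on_inverse_power_abs_int)
qed (use assms in \<open>auto intro: divide_right_mono\<close>)

lemma seq_dist_le:
  assumes "\<And>k. dist (x k) (y k) \<le> D"
  shows "seq_dist x y \<le> D * weight_sum"
proof -
  have "seq_dist x y \<le> (\<Sum>\<^sub>\<infinity>k::int. D * (1 / 2 ^ nat \<bar>k\<bar>))"
    unfolding seq_dist_def
    by (intro infsum_mono summable_on_seq_dist[OF assms] summable_on_cmult_right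
        summable_on_inverse_power_abs_int) (use assms in \<open>auto intro: divide_right_mono\<close>)
  also have "\<dots> = D * weight_sum"
    unfolding weight_sum_def by (rule infsum_cmult_right')
  finally show ?thesis .
qed

lemma dist_le_diameter_UNIV:
  fixes a b :: "'a::metric_space"
  assumes "compact (UNIV :: 'a set)"
  shows "dist a b \<le> diameter (UNIV :: 'a set)"
  using assms by (simp add: compact_imp_bounded diameter_bounded_bound)

lemma Metric_space_seq_dist:
  assumes "compact (UNIV :: 'a::metric_space set)"
  shows "Metric_space UNIV (seq_dist :: (int \<Rightarrow> 'a) \<Rightarrow> _)"
proof
  note summ = summable_on_seq_dist[OF dist_le_diameter_UNIV[OF assms]]
  fix x y z :: "int \<Rightarrow> 'a"
  show "0 \<le> seq_dist x y"
    unfolding seq_dist_def by (intro infsum_nonneg) auto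
  show "seq_dist x y = seq_dist y x"
    unfolding seq_dist_def by (simp add: dist_commute)
  show "seq_dist x y = 0 \<longleftrightarrow> x = y"
  proof
    assume "seq_dist x y = 0"
    then have "dist (x k) (y k) / 2 ^ nat \<bar>k\<bar> = 0" for k
      by (intro nonneg_infsum_le_0D[OF _ summ[of x y]]) (auto simp: seq_dist_def)
    then show "x = y" by auto
  qed (simp add: seq_dist_def)
  have "seq_dist x z \<le> (\<Sum>\<^sub>\<infinity>k. dist (x k) (y k) / 2 ^ nat \<bar>k\<bar> + dist (y k) (z k) / 2 ^ nat \<bar>k\<bar>)"
    unfolding seq_dist_def
  proof (intro infsum_mono summable_on_add summ)
    show "dist (x k) (z k) / 2 ^ nat \<bar>k\<bar>
        \<le> dist (x k) (y k) / 2 ^ nat \<bar>k\<bar> + dist (y k) (z k) / 2 ^ nat \<bar>k\<bar>" for k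
      unfolding add_divide_distrib[symmetric] by (intro divide_right_mono dist_triangle) auto
  qed
  also have "\<dots> = seq_dist x y + seq_dist y z"
    unfolding seq_dist_def by (intro infsum_add summ)
  finally show "seq_dist x z \<le> seq_dist x y + seq_dist y z" .
qed

text \<open>Weierstrass M-test with majorant \<open>?D * (1 / 2 ^ nat \<bar>k\<bar>)\<close>: each
  finite partial sum involves finitely many coordinates and is continuous, and the convergence is
  uniform. General families \<open>F\<close> and \<open>G\<close> cover both the distance to a fixed
  sequence and the defect of a sequence.\<close>

lemma continuous_on_seq_dist:
  fixes F G :: "'b::topological_space \<Rightarrow> int \<Rightarrow> 'a::metric_space"
  assumes "compact (UNIV :: 'a set)"
    and F: "\<And>k. continuous_on S (\<lambda>x. F x k)" and G: "\<And>k. continuous_on S (\<lambda>x. G x k)"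
  shows "continuous_on S (\<lambda>x. seq_dist (F x) (G x))"
  unfolding seq_dist_def
proof (rule uniform_limit_theorem)
  let ?D = "diameter (UNIV :: 'a set)"
  show "uniform_limit S (\<lambda>I x. \<Sum>k\<in>I. dist (F x k) (G x k) / 2 ^ nat \<bar>k\<bar>)
          (\<lambda>x. \<Sum>\<^sub>\<infinity>k. dist (F x k) (G x k) / 2 ^ nat \<bar>k\<bar>) (finite_subsets_at_top UNIV)"
  proof (rule Weierstrass_m_test_general)
    show "(\<lambda>k::int. ?D * (1 / 2 ^ nat \<bar>k\<bar>)) summable_on UNIV"
      by (intro summable_on_cmult_right summable_on_inverse_power_abs_int)
  qed (use dist_le_diameter_UNIV[OF assms(1)] in \<open>auto intro: divide_right_mono\<close>)
  show "\<forall>\<^sub>F I in finite_subsets_at_top UNIV.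
      continuous_on S (\<lambda>x. \<Sum>k\<in>I. dist (F x k) (G x k) / 2 ^ nat \<bar>k\<bar>)"
    by (intro always_eventually allI continuous_intros F G) auto
qed auto

text \<open>Transfers openness to the product topology of the function type, where Tychonoff's
  theorem gives compactness. Each ball of \<open>seq_dist\<close> is open there because
  \<open>seq_dist z\<close> is continuous in the coordinates.\<close>

lemma open_if_openin_tychonoff:
  fixes V :: "(int \<Rightarrow> 'a::metric_space) set"
  assumes "compact (UNIV :: 'a set)" and V: "openin tychonoff_topology V"
  shows "open V"
proof (subst open_subopen, intro ballI)
  interpret Metric_space UNIV "seq_dist :: (int \<Rightarrow> 'a) \<Rightarrow> _"
    by (rule Metric_space_seq_dist[OF assms(1)])
  fix z assume "z \<in> V"
  then obtain r where r: "r > 0" "mball z r \<subseteq> V"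
    using V unfolding tychonoff_topology_def openin_mtopology by blast
  have "open {x. seq_dist z x < r}"
    by (intro open_Collect_less continuous_on_seq_dist assms(1) continuous_on_const
        continuous_on_product_coordinates)
  then show "\<exists>T. open T \<and> z \<in> T \<and> T \<subseteq> V"
    using r by (intro exI[of _ "{x. seq_dist z x < r}"]) (auto simp: mball_def subset_iff)
qed

lemma compact_UNIV_fun:
  assumes "compact (UNIV :: 'b::topological_space set)"
  shows "compact (UNIV :: ('a \<Rightarrow> 'b) set)"
proof -
  have "compact_space (product_topology (\<lambda>_::'a. euclidean :: 'b topology) UNIV)"
    using assms by (simp only: compact_space_product_topology) (simp add: compact_space_def)
  then show ?thesis
    by (simp add: compact_space_def euclidean_product_topology)
qed

text \<open>Isolates the part that does not mention coverings: afterwards \<open>U\<close> enters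
  only through the one-step tolerance \<epsilon>.\<close>

lemma neighbourhood_contains_pseudo_orbits:
  fixes f :: "'a::metric_space \<Rightarrow> 'a"
  assumes "compact (UNIV :: 'a set)" and f: "continuous_on UNIV f"
    and "set_neighbourhood tychonoff_topology (trajectories f) U"
  obtains \<epsilon> where "\<epsilon> > 0" "\<And>x. (\<And>k. dist (f (x k)) (x (k + 1)) \<le> \<epsilon>) \<Longrightarrow> x \<in> U"
proof -
  interpret Metric_space UNIV "seq_dist :: (int \<Rightarrow> 'a) \<Rightarrow> _"
    by (rule Metric_space_seq_dist[OF assms(1)])
  define h where "h x = seq_dist (\<lambda>k. f (x k)) (\<lambda>k. x (k + 1))" for x
  obtain V where V: "openin tychonoff_topology V" "trajectories f \<subseteq> V" "V \<subseteq> U"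
    using assms(3) unfolding set_neighbourhood_def by blast
  have "compact (- V)"
    using compact_Int_closed[OF compact_UNIV_fun[OF assms(1)], of "- V"]
      open_if_openin_tychonoff[OF assms(1) V(1)] by (simp add: closed_Compl)
  moreover have "continuous_on (- V) h"
    unfolding h_def
    by (intro continuous_on_seq_dist assms(1) continuous_on_compose2[OF f]
        continuous_on_subset[OF continuous_on_product_coordinates]) auto
  moreover have "h x > 0" if "x \<in> - V" for x
  proof -
    have "x \<notin> trajectories f"
      using that V(2) by blast
    then have "(\<lambda>k. f (x k)) \<noteq> (\<lambda>k. x (k + 1))"
      by (simp add: trajectories_def fun_eq_iff eq_commute)
    then show ?thesis
      unfolding h_def by (simp add: mdist_pos_less)
  qed
  \<comment> \<open>If \<open>V = UNIV\<close>, the complement is empty and has no minimum to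
    attain; the bound is then vacuous and 1 serves as \<delta>.\<close>
  ultimately obtain \<delta> where \<delta>: "\<delta> > 0" "\<And>x. x \<in> - V \<Longrightarrow> h x \<ge> \<delta>"
    by (cases "V = UNIV") (auto dest!: continuous_attains_inf intro: that[of 1])
  \<comment> \<open>Adding 1 keeps the denominator positive given only
    \<open>weight_sum_nonneg\<close>, and makes \<open>\<epsilon> * weight_sum < \<delta>\<close>
    strict.\<close>
  define \<epsilon> where "\<epsilon> = \<delta> / (weight_sum + 1)"
  have "\<epsilon> > 0" "\<epsilon> * weight_sum < \<delta>"
    using \<delta>(1) weight_sum_nonneg by (auto simp: \<epsilon>_def field_simps)
  moreover have "x \<in> U" if "\<And>k. dist (f (x k)) (x (k + 1)) \<le> \<epsilon>" for x
  proof -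
    have "h x < \<delta>"
      using seq_dist_le[of "\<lambda>k. f (x k)" "\<lambda>k. x (k + 1)", OF that] \<open>\<epsilon> * weight_sum < \<delta>\<close>
      unfolding h_def by linarith
    then show ?thesis using \<delta>(2)[of x] V(3) by auto
  qed
  ultimately show thesis using that by blast
qed

text \<open>\<open>diameter\<close> controls distances only on bounded sets; compactness of the
  space makes every cell bounded.\<close>

lemma dist_le_covering_diameter:
  fixes M :: "nat \<Rightarrow> 'a::metric_space set"
  assumes "compact (UNIV :: 'a set)" and "i \<in> {1..n}" and "a \<in> M i" "b \<in> M i"
  shows "dist a b \<le> covering_diameter n M"
proof -
  have "dist a b \<le> diameter (M i)"
    using assms by (meson bounded_subset compact_imp_bounded diameter_bounded_bound subset_UNIV)
  also have "\<dots> \<le> covering_diameter n M"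
    unfolding covering_diameter_def using assms(2) by (intro Max_ge) auto
  finally show ?thesis .
qed

text \<open>The arc from \<open>\<omega> k\<close> to \<open>\<omega> (k + 1)\<close> supplies
  \<open>y\<close>, which shares a cell with \<open>x k\<close> while \<open>f y\<close> shares one
  with \<open>x (k + 1)\<close>.\<close>

lemma trace_step:
  assumes "admissible_path (symbolic_image f n M) \<omega>" and "is_trace M \<omega> x"
  obtains y where "\<omega> k \<in> {1..n}" "\<omega> (k + 1) \<in> {1..n}" "x k \<in> M (\<omega> k)" "y \<in> M (\<omega> k)"
    "f y \<in> M (\<omega> (k + 1))" "x (k + 1) \<in> M (\<omega> (k + 1))"
  using assms unfolding admissible_path_def is_trace_def symbolic_image_def
  by (fastforce simp: arcs_ends_def arc_to_ends_def)

theorem theorem5: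
  fixes A :: "('a::metric_space, 'e::real_normed_vector) chart set"
    and g :: "('a, 'e) metric_tensor"
    and f f' :: "'a \<Rightarrow> 'a"
    and U :: "(int \<Rightarrow> 'a) set"
  assumes "compact_riemannian_manifold A g"
    and "homeomorphism UNIV UNIV f f'"
    and "set_neighbourhood tychonoff_topology (trajectories f) U"
  shows "\<exists>d0>0. \<forall>n M. cell_covering TYPE('e) n M \<and> covering_diameter n M \<le> d0 \<longrightarrow>
           (\<forall>\<omega> x. admissible_path (symbolic_image f n M) \<omega> \<and> is_trace M \<omega> x \<longrightarrow> x \<in> U)"
proof -
  have cpt: "compact (UNIV :: 'a set)" and f: "continuous_on UNIV f"
    using assms(1,2) by (auto simp: compact_riemannian_manifold_def homeomorphism_def)
  obtain \<epsilon> where \<epsilon>: "\<epsilon> > 0" "\<And>x. (\<And>k. dist (f (x k)) (x (k + 1)) \<le> \<epsilon>) \<Longrightarrow> x \<in> U"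
    using neighbourhood_contains_pseudo_orbits[OF cpt f assms(3)] by blast
  obtain \<eta> where \<eta>: "\<eta> > 0" "\<And>a b. dist a b < \<eta> \<Longrightarrow> dist (f a) (f b) < \<epsilon> / 2"
    using compact_uniformly_continuous[OF f cpt] \<epsilon>(1)
    unfolding uniformly_continuous_on_def by (metis UNIV_I half_gt_zero)
  \<comment> \<open>Halving \<eta> turns the weak bound on the diameter into the strict one that
    uniform continuity asks for; \<open>\<epsilon> / 2\<close> bounds the second leg, from
    \<open>f y\<close> to \<open>x (k + 1)\<close>, of the triangle inequality.\<close>
  define d0 where "d0 = min (\<eta> / 2) (\<epsilon> / 2)"
  have "x \<in> U"
    if diam: "covering_diameter n M \<le> d0"
      and path: "admissible_path (symbolic_image f n M) \<omega>" and trace: "is_trace M \<omega> x"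
    for n M \<omega> x
  proof (rule \<epsilon>(2))
    fix k
    obtain y where y: "\<omega> k \<in> {1..n}" "\<omega> (k + 1) \<in> {1..n}" "x k \<in> M (\<omega> k)" "y \<in> M (\<omega> k)"
      "f y \<in> M (\<omega> (k + 1))" "x (k + 1) \<in> M (\<omega> (k + 1))"
      using trace_step[OF path trace] .
    have "dist (x k) y < \<eta>"
      using dist_le_covering_diameter[where M = M, OF cpt y(1,3,4)] diam \<eta>(1) by (auto simp: d0_def)
    then have "dist (f (x k)) (f y) < \<epsilon> / 2"
      by (rule \<eta>(2))
    moreover have "dist (f y) (x (k + 1)) \<le> \<epsilon> / 2"
      using dist_le_covering_diameter[where M = M, OF cpt y(2,5,6)] diam by (auto simp: d0_def)
    ultimately show "dist (f (x k)) (x (k + 1)) \<le> \<epsilon>"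
      using dist_triangle[of "f (x k)" "x (k + 1)" "f y"] by linarith
  qed
  moreover have "d0 > 0"
    using \<epsilon>(1) \<eta>(1) by (simp add: d0_def)
  ultimately show ?thesis by blast
qed

end
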